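(* For $f\in L^1(X,\nu)$ and $\lambda>0$ there exists (at least) one minimizer of the variational problem $$\min_{u\in L^1(X,\nu)}\left\{TV_m(u)+\lambda\int_X|u-f|\,d\nu\right\}.$$
   Context: Setting: $(X,d)$ is a Polish metric space with its Borel $\sigma$-algebra. A random walk $m=(m_x)_{x\in X}$ on $X$ is a family of Borel probability measures on $X$ such that $x\mapsto m_x(A)$ is Borel for every Borel $A\subset X$ and $\int_X d(z,y)\,dm_x(y)<\infty$ for all $x\in X$ and some (hence any) $z\in X$; $[X,d,m]$ is a metric random walk space. $\nu$ is a finite (nonzero) Radon measure on $X$ which is reversible for $m$: $dm_x(y)d\nu(x)=dm_y(x)d\nu(y)$ as measures on $X\times X$ (this implies invariance, $\nu(A)=\int_X m_x(A)\,d\nu(x)$). It is also assumed that $\frac1{\nu(X)}\nu$ is ergodic with respect to $m$: every Borel set $B$ with $m_x(B)=1$ for all $x\in B$ satisfies $\nu(B)=0$ or $\nu(B)=\nu(X)$. $m$-total variation: $TV_m(u)=\frac12\int_X\int_X|u(y)-u(x)|\,dm_x(y)\,d\nu(x)$. *)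

theory Defs
  imports "HOL-Analysis.Analysis" "HOL-Probability.Probability_Measure"
begin

text \<open>The Polish metric space \<open>X\<close> is a type of class \<^class>\<open>polish_space\<close> (complete and
  second countable), with its metric \<^const>\<open>dist\<close> and the \<open>\<sigma>\<close>-algebra \<^term>\<open>sets borel\<close>.\<close>

definition metric_random_walk :: "('a::polish_space \<Rightarrow> 'a measure) \<Rightarrow> bool" where
  "metric_random_walk m \<longleftrightarrow>
     (\<forall>x. sets (m x) = sets borel \<and> prob_space (m x)) \<and>
     (\<forall>A\<in>sets borel. (\<lambda>x. emeasure (m x) A) \<in> borel_measurable borel) \<and>
     (\<exists>z. \<forall>x. (\<integral>\<^sup>+ y. ennreal (dist z y) \<partial>m x) < \<infinity>)"

text \<open>For finite Borel measures on a Polish space the inner regularity clause holds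
  automatically; it is included so that the definition is that of a Radon measure.\<close>

definition finite_radon_measure :: "'a::polish_space measure \<Rightarrow> bool" where
  "finite_radon_measure \<nu> \<longleftrightarrow>
     sets \<nu> = sets borel \<and> finite_measure \<nu> \<and>
     (\<forall>B\<in>sets borel. emeasure \<nu> B = (SUP K\<in>{K. K \<subseteq> B \<and> compact K}. emeasure \<nu> K))"

text \<open>The measures \<open>dm\<^sub>x(y) d\<nu>(x)\<close> and \<open>dm\<^sub>y(x) d\<nu>(y)\<close> on \<open>X \<times> X\<close> agree on every measurable set.
  On the right-hand side the second coordinate \<open>y\<close> is distributed according to \<open>\<nu>\<close> and, given
  \<open>y\<close>, the first coordinate \<open>x\<close> according to \<open>m\<^sub>y\<close>.\<close>

definition reversible :: "('a::polish_space \<Rightarrow> 'a measure) \<Rightarrow> 'a measure \<Rightarrow> bool" where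
  "reversible m \<nu> \<longleftrightarrow>
     (\<forall>C\<in>sets (borel \<Otimes>\<^sub>M borel).
        (\<integral>\<^sup>+ x. (\<integral>\<^sup>+ y. indicator C (x, y) \<partial>m x) \<partial>\<nu>) =
        (\<integral>\<^sup>+ y. (\<integral>\<^sup>+ x. indicator C (x, y) \<partial>m y) \<partial>\<nu>))"

text \<open>Ergodicity of \<open>\<nu> / \<nu>(X)\<close>, with the normalisation cleared.\<close>

definition ergodic :: "('a::polish_space \<Rightarrow> 'a measure) \<Rightarrow> 'a measure \<Rightarrow> bool" where
  "ergodic m \<nu> \<longleftrightarrow>
     (\<forall>B\<in>sets borel. (\<forall>x\<in>B. emeasure (m x) B = 1) \<longrightarrow>
        emeasure \<nu> B = 0 \<or> emeasure \<nu> B = emeasure \<nu> UNIV)"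

text \<open>The total variation takes values in \<^typ>\<open>ennreal\<close>, so that no integrability is needed for the
  definition; it is finite for integrable \<open>u\<close> when \<open>\<nu>\<close> is reversible.\<close>

definition TV :: "('a::polish_space \<Rightarrow> 'a measure) \<Rightarrow> 'a measure \<Rightarrow> ('a \<Rightarrow> real) \<Rightarrow> ennreal" where
  "TV m \<nu> u = (1 / 2) * (\<integral>\<^sup>+ x. (\<integral>\<^sup>+ y. ennreal \<bar>u y - u x\<bar> \<partial>m x) \<partial>\<nu>)"

end

theory Submission
  imports Defs "HOL-Probability.Giry_Monad"
begin

text \<open>
  The functional is convex, lower semicontinuous under almost everywhere convergence, and, since
  \<open>lam > 0\<close>, its sublevel sets are bounded in \<open>L\<^sup>1\<close>. Bounded sets of \<open>L\<^sup>1\<close> need not be weakly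
  relatively compact, and the total variation of a random walk gives no compactness either, so an arbitrary
  minimizing sequence need not converge. The remedy is to choose a good one: among the
  functions whose value is within \<open>1/(n+1)\<close> of the infimum, \<open>u\<^sub>n\<close> almost minimizes the strictly
  convex functional \<open>\<Phi>(u) = \<integral> sqrt (1 + u\<^sup>2) d\<nu>\<close>, which is finite on \<open>L\<^sup>1\<close> because \<open>\<nu>\<close> is finite.

  The infima of \<open>\<Phi>\<close> on these shrinking sublevel sets increase and are bounded, hence they
  converge. The sublevel sets are closed under midpoints, so the convexity gap
  \<open>(\<Phi>(u\<^sub>i) + \<Phi>(u\<^sub>j)) / 2 - \<Phi>((u\<^sub>i + u\<^sub>j) / 2)\<close> tends to 0. The lemma \<open>sqrt_diff_le_gap\<close>
  turns this into the statement that the signed square roots of the \<open>u\<^sub>n\<close> form a Cauchy sequence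
  in \<open>L\<^sup>1\<close>. The \<open>u\<^sub>n\<close> themselves need not be Cauchy in \<open>L\<^sup>1\<close>, since mass may concentrate, but a
  subsequence converges almost everywhere to a finite limit. Fatou's lemma shows that this limit is
  integrable and a minimizer. This abstract result is \<open>convex_coercive_minimizer\<close>.

  For the random walk, Fatou's lemma is applied to the iterated integral over \<open>m\<^sub>x\<close> and \<open>\<nu>\<close>.
  The convergence of \<open>u\<^sub>n(y)\<close> has to hold for \<open>m\<^sub>x\<close>-almost every \<open>y\<close>, for \<open>\<nu>\<close>-almost every \<open>x\<close>;
  this is where reversibility enters, through the invariance of \<open>\<nu>\<close>
  (lemma \<open>reversible_imp_AE_AE\<close>).
\<close>

section \<open>The convexity gap of the function \<open>sqrt (1 + t\<^sup>2)\<close>\<close>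

text \<open>
  \<open>A\<close>, \<open>B\<close> and \<open>2 M\<close> are the lengths of the plane vectors \<open>(1, s)\<close>, \<open>(1, t)\<close> and of their sum, so the
  gap is half the defect in the triangle inequality. Multiplied by the conjugate
  \<open>(A + B) / 2 + M\<close>, it becomes half the defect \<open>D\<close> in the Cauchy--Schwarz inequality, and
  multiplying \<open>D\<close> by its conjugate gives the squared area \<open>(s - t)\<^sup>2\<close> by Lagrange's identity.
\<close>

lemma gap_lower_bound:
  fixes s t :: real
  defines "A \<equiv> sqrt (1 + s\<^sup>2)" and "B \<equiv> sqrt (1 + t\<^sup>2)"
    and "M \<equiv> sqrt (1 + ((s + t) / 2)\<^sup>2)"
  shows "(s - t)\<^sup>2 \<le> ((A + B) / 2 - M) * (A + B) ^ 3" and "M \<le> (A + B) / 2"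
proof -
  have A: "A \<ge> 1" "A\<^sup>2 = 1 + s\<^sup>2" and B: "B \<ge> 1" "B\<^sup>2 = 1 + t\<^sup>2"
    and M: "M \<ge> 1" "M\<^sup>2 = 1 + ((s + t) / 2)\<^sup>2"
    unfolding A_def B_def M_def by auto
  define D where "D = A * B - 1 - s * t"
  have AB: "(A * B)\<^sup>2 = (1 + s * t)\<^sup>2 + (s - t)\<^sup>2"
    unfolding power_mult_distrib A(2) B(2) by (simp add: power2_eq_square algebra_simps)
  have AB1: "A * B \<ge> 1" using mult_mono[of 1 A 1 B] A(1) B(1) by simp
  have st: "\<bar>1 + s * t\<bar> \<le> A * B"
    using AB AB1 by (auto intro: power2_le_imp_le[of "\<bar>1 + s * t\<bar>" "A * B"])
  have D0: "D \<ge> 0" using st unfolding D_def by linarith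
  have "(s - t)\<^sup>2 = D * (A * B + 1 + s * t)"
    using AB unfolding D_def by (simp add: power2_eq_square algebra_simps)
  also have "\<dots> \<le> D * (2 * (A * B))"
    using D0 st by (intro mult_left_mono) auto
  finally have 1: "(s - t)\<^sup>2 \<le> 2 * D * (A * B)" by simp
  have 2: "((A + B) / 2 - M) * ((A + B) / 2 + M) = D / 2"
  proof -
    have "((A + B) / 2 - M) * ((A + B) / 2 + M) = (A\<^sup>2 + B\<^sup>2 + 2 * A * B) / 4 - M\<^sup>2"
      by (simp add: power2_eq_square field_simps)
    also have "\<dots> = D / 2"
      unfolding A(2) B(2) M(2) D_def by (simp add: power2_eq_square field_simps)
    finally show ?thesis .
  qed
  show 3: "M \<le> (A + B) / 2"
  proof (rule ccontr)
    assume "\<not> M \<le> (A + B) / 2"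
    then have "((A + B) / 2 - M) * ((A + B) / 2 + M) < 0"
      using A(1) B(1) M(1) by (intro mult_neg_pos add_pos_pos) auto
    then show False using 2 D0 by simp
  qed
  have "D / 2 \<le> ((A + B) / 2 - M) * (A + B)"
    unfolding 2[symmetric] using 3 field_sum_of_halves[of "A + B"]
    by (intro mult_left_mono) linarith+
  moreover have "4 * (A * B) \<le> (A + B)\<^sup>2"
    using sum_squares_bound[of A B] by (simp add: power2_eq_square algebra_simps)
  ultimately have 4: "(D / 2) * (4 * (A * B)) \<le> (((A + B) / 2 - M) * (A + B)) * (A + B)\<^sup>2"
    using D0 AB1 3 A(1) B(1) by (intro mult_mono) auto
  have "(s - t)\<^sup>2 \<le> (D / 2) * (4 * (A * B))" using 1 by (simp add: ac_simps)
  also note 4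
  also have "(((A + B) / 2 - M) * (A + B)) * (A + B)\<^sup>2 = ((A + B) / 2 - M) * (A + B) ^ 3"
    by (simp add: power2_eq_square power3_eq_cube mult.assoc)
  finally show "(s - t)\<^sup>2 \<le> ((A + B) / 2 - M) * (A + B) ^ 3" .
qed

text \<open>
  The function \<^const>\<open>sqrt\<close> is odd, so that it is a homeomorphism of the real line, and it is
  Hoelder continuous of order \<open>1/2\<close> also across 0; the factor 2 is caused by arguments of
  opposite signs.
\<close>

lemma sqrt_diff_power2_le:
  fixes s t :: real
  shows "(sqrt s - sqrt t)\<^sup>2 \<le> 2 * \<bar>s - t\<bar>"
proof -
  have same: "(sqrt a - sqrt b)\<^sup>2 \<le> 2 * (a - b)" if "0 \<le> b" "b \<le> a" for a b :: real
  proof -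
    have "sqrt b * sqrt b \<le> sqrt a * sqrt b"
      using that by (intro mult_right_mono) auto
    then show ?thesis using that by (simp add: power2_diff)
  qed
  have opp: "(sqrt a + sqrt b)\<^sup>2 \<le> 2 * (a + b)" if "0 \<le> b" "0 \<le> a" for a b :: real
    using sum_squares_bound[of "sqrt a" "sqrt b"] that by (simp add: power2_sum)
  consider "0 \<le> t" "t \<le> s" | "0 \<le> s" "s \<le> t" | "s \<le> t" "t \<le> 0" | "t \<le> s" "s \<le> 0"
    | "s \<le> 0" "0 \<le> t" | "t \<le> 0" "0 \<le> s" by linarith
  then show ?thesis
  proof cases
    case 1 then show ?thesis using same[of t s] by simp
  next
    case 2 then show ?thesis using same[of s t] by (simp add: power2_commute)
  next
    case 3 then show ?thesis using same[of "-t" "-s"]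
      by (simp add: real_sqrt_minus power2_commute)
  next
    case 4 then show ?thesis using same[of "-s" "-t"]
      by (simp add: real_sqrt_minus power2_commute)
  next
    case 5 then show ?thesis using opp[of "-s" t]
      by (simp add: real_sqrt_minus power2_eq_square algebra_simps)
  next
    case 6 then show ?thesis using opp[of "-t" s]
      by (simp add: real_sqrt_minus power2_eq_square algebra_simps)
  qed
qed

text \<open>
  By the two previous estimates the fourth power of \<open>X = \<bar>sqrt s - sqrt t\<bar>\<close> is at most
  \<open>4 q (A + B)\<^sup>3\<close>, where \<open>q\<close> is the gap. This is a form of Young's inequality: if
  \<open>X > \<epsilon> (A + B)\<close>, then \<open>A + B\<close> can be replaced by \<open>X / \<epsilon>\<close> and three powers of \<open>X\<close> cancel.
  The right-hand side is linear in \<open>A\<close>, \<open>B\<close> and \<open>M\<close>, hence can be integrated.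
\<close>

lemma sqrt_diff_le_gap:
  fixes s t \<epsilon> :: real
  defines "A \<equiv> sqrt (1 + s\<^sup>2)" and "B \<equiv> sqrt (1 + t\<^sup>2)"
    and "M \<equiv> sqrt (1 + ((s + t) / 2)\<^sup>2)"
  assumes "\<epsilon> > 0"
  shows "\<bar>sqrt s - sqrt t\<bar> \<le> \<epsilon> * (A + B) + 4 / \<epsilon> ^ 3 * ((A + B) / 2 - M)"
proof -
  define X where "X = \<bar>sqrt s - sqrt t\<bar>"
  define q where "q = (A + B) / 2 - M"
  have gap: "(s - t)\<^sup>2 \<le> q * (A + B) ^ 3" and q: "q \<ge> 0"
    using gap_lower_bound[of s t] unfolding q_def A_def B_def M_def by auto
  have AB: "A + B \<ge> 0" unfolding A_def B_def by simp
  have "X\<^sup>2 \<le> 2 * \<bar>s - t\<bar>" using sqrt_diff_power2_le[of s t] unfolding X_def by simp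
  then have "(X\<^sup>2)\<^sup>2 \<le> (2 * \<bar>s - t\<bar>)\<^sup>2" by (intro power_mono) auto
  then have X4: "X ^ 4 \<le> 4 * (q * (A + B) ^ 3)" using gap by (simp add: power_mult_distrib)
  show ?thesis
  proof (cases "X \<le> \<epsilon> * (A + B)")
    case True
    have "0 \<le> 4 / \<epsilon> ^ 3 * q" using q \<open>\<epsilon> > 0\<close> by simp
    then show ?thesis using True unfolding X_def q_def by linarith
  next
    case False
    then have X0: "X > 0" using AB \<open>\<epsilon> > 0\<close> by (smt (verit) mult_nonneg_nonneg)
    have "A + B \<le> X / \<epsilon>" using False \<open>\<epsilon> > 0\<close> by (simp add: field_simps)
    then have "(A + B) ^ 3 \<le> (X / \<epsilon>) ^ 3" using AB by (intro power_mono) auto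
    then have "4 * (q * (A + B) ^ 3) \<le> 4 * (q * (X / \<epsilon>) ^ 3)"
      using q by (intro mult_left_mono) auto
    with X4 have "X ^ 4 \<le> 4 * (q * (X / \<epsilon>) ^ 3)" by linarith
    then have "X * X ^ 3 \<le> (4 / \<epsilon> ^ 3 * q) * X ^ 3"
      by (simp add: power_divide eval_nat_numeral algebra_simps)
    then have "X \<le> 4 / \<epsilon> ^ 3 * q" 
      using X0 by (intro mult_right_le_imp_le[of X "X ^ 3"]) auto
    moreover have "0 \<le> \<epsilon> * (A + B)" using AB \<open>\<epsilon> > 0\<close> by simp
    ultimately show ?thesis unfolding X_def q_def by linarith
  qed
qed

section \<open>Minimizers of coercive convex functionals on integrable functions\<close>

lemma (in finite_measure) integrable_sqrt_one_plus_power2: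
  fixes u :: "'a \<Rightarrow> real"
  assumes "integrable M u"
  shows "integrable M (\<lambda>x. sqrt (1 + (u x)\<^sup>2))"
    and "(\<integral>x. sqrt (1 + (u x)\<^sup>2) \<partial>M) \<le> measure M (space M) + (\<integral>x. \<bar>u x\<bar> \<partial>M)"
proof -
  have u[measurable]: "u \<in> borel_measurable M" using assms by simp
  have le: "sqrt (1 + (u x)\<^sup>2) \<le> 1 + \<bar>u x\<bar>" for x
    by (intro real_le_lsqrt) (auto simp: power2_eq_square algebra_simps)
  have int: "integrable M (\<lambda>x. 1 + \<bar>u x\<bar>)" using assms by auto
  show 1: "integrable M (\<lambda>x. sqrt (1 + (u x)\<^sup>2))"
    by (rule Bochner_Integration.integrable_bound[OF int]) (use le in auto)
  have "(\<integral>x. sqrt (1 + (u x)\<^sup>2) \<partial>M) \<le> (\<integral>x. 1 + \<bar>u x\<bar> \<partial>M)"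
    using le by (intro integral_mono 1 int)
  also have "\<dots> = measure M (space M) + (\<integral>x. \<bar>u x\<bar> \<partial>M)"
    using assms by simp
  finally show "(\<integral>x. sqrt (1 + (u x)\<^sup>2) \<partial>M) \<le> measure M (space M) + (\<integral>x. \<bar>u x\<bar> \<partial>M)" .
qed

text \<open>
  Integrating the previous estimate bounds the \<open>L\<^sup>1\<close> distance of the square roots by
  \<open>2 K \<epsilon>\<close> plus a multiple of the gap. First \<open>\<epsilon>\<close> and then the indices are chosen, so the square
  roots are Cauchy in \<open>L\<^sup>1\<close> and a subsequence of them converges almost everywhere to finite
  values.
\<close>

lemma (in finite_measure) AE_convergent_subseq_of_gap:
  fixes u :: "nat \<Rightarrow> 'a \<Rightarrow> real"
  defines "\<Phi> \<equiv> \<lambda>v. \<integral>x. sqrt (1 + (v x)\<^sup>2) \<partial>M"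
  assumes int: "\<And>n. integrable M (u n)"
    and bd: "\<And>n. \<Phi> (u n) \<le> K"
    and gap: "\<And>\<delta>. \<delta> > 0 \<Longrightarrow> \<exists>N. \<forall>i\<ge>N. \<forall>j\<ge>N.
        (\<Phi> (u i) + \<Phi> (u j)) / 2 - \<Phi> (\<lambda>x. (u i x + u j x) / 2) < \<delta>"
  obtains r where "strict_mono r" "AE x in M. convergent (\<lambda>n. u (r n) x)"
proof -
  have u[measurable]: "u n \<in> borel_measurable M" for n using int by auto
  have mid: "integrable M (\<lambda>x. (u i x + u j x) / 2)" for i j using int by auto
  note I = integrable_sqrt_one_plus_power2(1)
  have isq: "integrable M (\<lambda>x. sqrt (u n x))" for n
  proof (rule Bochner_Integration.integrable_bound)
    show "integrable M (\<lambda>x. 1 + \<bar>u n x\<bar>)" using int by auto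
    have "\<bar>sqrt t\<bar> \<le> 1 + \<bar>t\<bar>" for t :: real
    proof -
      have "\<bar>sqrt t\<bar> = sqrt \<bar>t\<bar>" by (simp add: abs_if real_sqrt_minus)
      also have "\<dots> \<le> 1 + \<bar>t\<bar>"
        by (intro real_le_lsqrt) (auto simp: power2_eq_square algebra_simps)
      finally show ?thesis .
    qed
    then show "AE x in M. norm (sqrt (u n x)) \<le> norm (1 + \<bar>u n x\<bar>)" by simp
  qed simp
  have est: "(\<integral>x. norm (sqrt (u i x) - sqrt (u j x)) \<partial>M) \<le>
     \<epsilon> * (2 * K) + 4 / \<epsilon> ^ 3 * ((\<Phi> (u i) + \<Phi> (u j)) / 2 - \<Phi> (\<lambda>x. (u i x + u j x) / 2))"
    if "\<epsilon> > 0" for i j \<epsilon>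
  proof -
    have "(\<integral>x. norm (sqrt (u i x) - sqrt (u j x)) \<partial>M) \<le>
      (\<integral>x. \<epsilon> * (sqrt (1 + (u i x)\<^sup>2) + sqrt (1 + (u j x)\<^sup>2)) + 4 / \<epsilon> ^ 3 *
        ((sqrt (1 + (u i x)\<^sup>2) + sqrt (1 + (u j x)\<^sup>2)) / 2 - sqrt (1 + ((u i x + u j x) / 2)\<^sup>2)) \<partial>M)"
    proof (rule integral_mono, goal_cases)
      case 1 show ?case using isq by auto
    next
      case 2 show ?case
        using I[OF int] I[OF mid] by auto
    next
      case (3 x) show ?case using sqrt_diff_le_gap[OF that] by simp
    qed
    also have "\<dots> = \<epsilon> * (\<Phi> (u i) + \<Phi> (u j)) +
       4 / \<epsilon> ^ 3 * ((\<Phi> (u i) + \<Phi> (u j)) / 2 - \<Phi> (\<lambda>x. (u i x + u j x) / 2))"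
      unfolding \<Phi>_def using I[OF int] I[OF mid] by simp
    also have "\<dots> \<le> \<epsilon> * (2 * K) +
       4 / \<epsilon> ^ 3 * ((\<Phi> (u i) + \<Phi> (u j)) / 2 - \<Phi> (\<lambda>x. (u i x + u j x) / 2))"
      using bd[of i] bd[of j] that by (intro add_right_mono mult_left_mono) auto
    finally show ?thesis .
  qed
  have "0 \<le> \<Phi> (u 0)" unfolding \<Phi>_def by (intro integral_nonneg_AE) auto
  then have K: "K \<ge> 0" using bd[of 0] by linarith
  have cauchy: "\<exists>N. \<forall>i\<ge>N. \<forall>j\<ge>N. (\<integral>x. norm (sqrt (u i x) - sqrt (u j x)) \<partial>M) < e"
    if "e > 0" for e
  proof -
    define \<epsilon> where "\<epsilon> = e / (4 * (K + 1))"
    have \<epsilon>: "\<epsilon> > 0" unfolding \<epsilon>_def using K that by simp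
    have \<epsilon>K: "\<epsilon> * (2 * K) < e / 2"
      unfolding \<epsilon>_def using K that by (simp add: field_simps)
    define \<delta> where "\<delta> = e / 2 / (4 / \<epsilon> ^ 3)"
    have "\<delta> > 0" unfolding \<delta>_def using \<epsilon> that by simp
    from gap[OF this] obtain N where N: "\<forall>i\<ge>N. \<forall>j\<ge>N.
        (\<Phi> (u i) + \<Phi> (u j)) / 2 - \<Phi> (\<lambda>x. (u i x + u j x) / 2) < \<delta>" ..
    have \<delta>: "4 / \<epsilon> ^ 3 * q < e / 2" if "q < \<delta>" for q
      using that \<epsilon> unfolding \<delta>_def by (simp add: field_simps)
    have "(\<integral>x. norm (sqrt (u i x) - sqrt (u j x)) \<partial>M) < e" if "i \<ge> N" "j \<ge> N" for i j
      using est[OF \<epsilon>, of i j] \<epsilon>K \<delta>[OF N[rule_format, OF that]] by linarith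
    then show ?thesis by blast
  qed
  obtain r where r: "strict_mono r" "AE x in M. Cauchy (\<lambda>i. sqrt (u (r i) x))"
    using cauchy_L1_AE_cauchy_subseq[of M "\<lambda>n x. sqrt (u n x)", OF isq] cauchy by blast
  \<comment> \<open>the inverse of the odd square root is the continuous function that sends \<open>l\<close> to \<open>l * \<bar>l\<bar>\<close>\<close>
  have inv: "sqrt t * \<bar>sqrt t\<bar> = t" for t :: real
    by (cases "t \<ge> 0") (auto simp: real_sqrt_minus real_sqrt_lt_0_iff abs_if)
  have "AE x in M. convergent (\<lambda>n. u (r n) x)"
    using r(2)
  proof eventually_elim
    case (elim x)
    then obtain l where "(\<lambda>i. sqrt (u (r i) x)) \<longlonglongrightarrow> l"
      using Cauchy_convergent convergent_def by blast
    then have "(\<lambda>i. sqrt (u (r i) x) * \<bar>sqrt (u (r i) x)\<bar>) \<longlonglongrightarrow> l * \<bar>l\<bar>"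
      by (intro tendsto_intros)
    then show ?case unfolding inv by (auto simp: convergent_def)
  qed
  with r(1) that show thesis by blast
qed

text \<open>
  Convexity is required only in the form that sublevel sets contain midpoints, and lower
  semicontinuity only along sequences that converge almost everywhere. In the nontrivial case
  \<open>J\<close> has a finite infimum \<open>a\<close>; \<open>C n\<close> is the set of \<open>e n\<close>-almost minimizers of \<open>J\<close>, and \<open>u n\<close> is
  an \<open>e n\<close>-almost minimizer of \<open>\<Phi>\<close> on \<open>C n\<close>.
\<close>

theorem (in finite_measure) convex_coercive_minimizer:
  fixes J :: "('a \<Rightarrow> real) \<Rightarrow> ennreal"
  assumes convex: "\<And>u v c. integrable M u \<Longrightarrow> integrable M v \<Longrightarrow> J u \<le> c \<Longrightarrow> J v \<le> c \<Longrightarrow>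
        J (\<lambda>x. (u x + v x) / 2) \<le> c"
    and coercive: "\<And>c. c < \<infinity> \<Longrightarrow> \<exists>K. \<forall>u. integrable M u \<longrightarrow> J u \<le> c \<longrightarrow> (\<integral>x. \<bar>u x\<bar> \<partial>M) \<le> K"
    and lsc: "\<And>u v. (\<And>n::nat. integrable M (u n)) \<Longrightarrow> integrable M v \<Longrightarrow>
        AE x in M. (\<lambda>n. u n x) \<longlonglongrightarrow> v x \<Longrightarrow> J v \<le> liminf (\<lambda>n. J (u n))"
  shows "\<exists>u. is_arg_min J (integrable M) u"
proof (cases "\<exists>u. integrable M u \<and> J u < \<infinity>")
  case False
  then have "is_arg_min J (integrable M) (\<lambda>_. 0)"
    unfolding is_arg_min_def by (auto simp: less_top[symmetric])
  then show ?thesis by blast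
next
  case True
  define a where "a = (INF u\<in>{u. integrable M u}. J u)"
  have a_le: "a \<le> J u" if "integrable M u" for u
    unfolding a_def using that by (auto intro: INF_lower)
  have a_fin: "a < \<infinity>" using True a_le by (meson le_less_trans)
  define \<Phi> where "\<Phi> v = (\<integral>x. sqrt (1 + (v x)\<^sup>2) \<partial>M)" for v :: "'a \<Rightarrow> real"
  define e where "e n = 1 / real (Suc n)" for n
  have e_pos: "e n > 0" for n unfolding e_def by simp
  have e_anti: "e n \<le> e k" if "k \<le> n" for k n
    unfolding e_def using that by (simp add: frac_le)
  have e_lim: "e \<longlonglongrightarrow> 0" unfolding e_def by (rule LIMSEQ_Suc[OF lim_1_over_n])
  define C where "C n = {u. integrable M u \<and> J u \<le> a + ennreal (e n)}" for n
  have C_anti: "C n \<subseteq> C k" if "k \<le> n" for k n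
    unfolding C_def using e_anti[OF that]
    by (auto elim!: order_trans intro!: add_left_mono ennreal_leI)
  have C_ne: "C n \<noteq> {}" for n
  proof -
    have "a < a + ennreal (e n)"
      using a_fin e_pos[of n]
      by (cases a) (auto simp: ennreal_less_iff simp flip: ennreal_plus)
    then obtain u where "integrable M u" "J u < a + ennreal (e n)"
      unfolding a_def by (auto simp: INF_less_iff)
    then show ?thesis unfolding C_def by (auto intro: less_imp_le)
  qed
  have C_mid: "(\<lambda>x. (u x + v x) / 2) \<in> C n" if "u \<in> C n" "v \<in> C n" for u v n
    using that convex[of u v] unfolding C_def by auto
  have "a + ennreal (e 0) < \<infinity>" using a_fin by simp
  then obtain K where K: "\<And>u. u \<in> C 0 \<Longrightarrow> (\<integral>x. \<bar>u x\<bar> \<partial>M) \<le> K"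
    using coercive[of "a + ennreal (e 0)"] unfolding C_def by blast
  define L where "L = measure M (space M) + K"
  have \<Phi>_le: "\<Phi> u \<le> L" if "u \<in> C n" for u n
  proof -
    have u0: "u \<in> C 0" using C_anti[of 0 n] that by auto
    then have "integrable M u" unfolding C_def by simp
    from integrable_sqrt_one_plus_power2(2)[OF this] K[OF u0] show ?thesis
      unfolding \<Phi>_def L_def by linarith
  qed
  have bdd: "bdd_below (\<Phi> ` C n)" for n
    unfolding \<Phi>_def by (intro bdd_belowI[where m=0]) (auto intro!: integral_nonneg_AE)
  define b where "b n = (INF u\<in>C n. \<Phi> u)" for n
  have b_lower: "b n \<le> \<Phi> u" if "u \<in> C n" for u n
    unfolding b_def using that bdd by (intro cINF_lower)
  have b_mono: "incseq b"
    unfolding incseq_def b_def using C_anti C_ne bdd by (auto intro!: cINF_superset_mono)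
  have b_le: "b n \<le> L" for n using C_ne[of n] b_lower[of _ n] \<Phi>_le[of _ n] by (meson all_not_in_conv order_trans)
  obtain B where B: "b \<longlonglongrightarrow> B" "\<And>n. b n \<le> B"
    using incseq_convergent[OF b_mono, of L] b_le by auto
  have "\<exists>u. u \<in> C n \<and> \<Phi> u < b n + e n" for n
  proof -
    have "(INF u\<in>C n. \<Phi> u) < b n + e n" unfolding b_def[symmetric] using e_pos by simp
    then show ?thesis using cINF_less_iff[OF C_ne bdd] by blast
  qed
  then obtain u where uC: "\<And>n. u n \<in> C n" and u\<Phi>: "\<And>n. \<Phi> (u n) < b n + e n" by metis
  have int: "integrable M (u n)" for n using uC[of n] unfolding C_def by simp
  \<comment> \<open>Midpoints of late terms stay in \<open>C N\<close>, so \<open>\<Phi>\<close> is at least \<open>b N\<close> there, while it is below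
    \<open>B + e N\<close> at the late terms themselves.\<close>
  have gap: "\<exists>N. \<forall>i\<ge>N. \<forall>j\<ge>N. (\<Phi> (u i) + \<Phi> (u j)) / 2 - \<Phi> (\<lambda>x. (u i x + u j x) / 2) < \<delta>"
    if "\<delta> > 0" for \<delta>
  proof -
    have "(\<lambda>n. B - b n + e n) \<longlonglongrightarrow> B - B + 0" by (intro tendsto_intros B e_lim)
    then have "(\<lambda>n. B - b n + e n) \<longlonglongrightarrow> 0" by simp
    then have "eventually (\<lambda>n. B - b n + e n < \<delta>) sequentially"
      using order_tendstoD(2) that by blast
    then obtain N where N: "B - b N + e N < \<delta>" by (auto simp: eventually_sequentially)
    have "(\<Phi> (u i) + \<Phi> (u j)) / 2 - \<Phi> (\<lambda>x. (u i x + u j x) / 2) < \<delta>" if "i \<ge> N" "j \<ge> N" for i j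
    proof -
      have "u i \<in> C N" "u j \<in> C N" using uC C_anti that by blast+
      from b_lower[OF C_mid[OF this]]
      have mid: "b N \<le> \<Phi> (\<lambda>x. (u i x + u j x) / 2)" .
      have top: "\<Phi> (u k) < B + e N" if "k \<ge> N" for k
        using u\<Phi>[of k] B(2)[of k] e_anti[OF that] by linarith
      have "\<Phi> (u i) + \<Phi> (u j) < (B + e N) + (B + e N)"
        using top[OF that(1)] top[OF that(2)] by linarith
      then have "(\<Phi> (u i) + \<Phi> (u j)) / 2 < B + e N" by simp
      with mid N show ?thesis by argo
    qed
    then show ?thesis by blast
  qed
  obtain r where r: "strict_mono r" and conv: "AE x in M. convergent (\<lambda>n. u (r n) x)"
    using AE_convergent_subseq_of_gap[of u L] int \<Phi>_le[OF uC] gap unfolding \<Phi>_def by blast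
  have um[measurable]: "u n \<in> borel_measurable M" for n using int by auto
  define v where "v x = lim (\<lambda>n. u (r n) x)" for x
  have vm[measurable]: "v \<in> borel_measurable M"
    unfolding v_def by (intro borel_measurable_lim_metric) simp
  have lim: "AE x in M. (\<lambda>n. u (r n) x) \<longlonglongrightarrow> v x"
    using conv unfolding v_def by (simp add: convergent_LIMSEQ_iff)
  have vint: "integrable M v"
  proof (rule integrableI_bounded)
    have "(\<integral>\<^sup>+x. ennreal (norm (v x)) \<partial>M) = (\<integral>\<^sup>+x. liminf (\<lambda>n. ennreal (norm (u (r n) x))) \<partial>M)"
    proof (rule nn_integral_cong_AE, use lim in eventually_elim)
      case (elim x)
      then have "(\<lambda>n. ennreal (norm (u (r n) x))) \<longlonglongrightarrow> ennreal (norm (v x))"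
        by (intro tendsto_intros)
      then show ?case by (simp only: lim_imp_Liminf[OF sequentially_bot])
    qed
    also have "\<dots> \<le> liminf (\<lambda>n. \<integral>\<^sup>+x. ennreal (norm (u (r n) x)) \<partial>M)"
      by (intro nn_integral_liminf) simp
    also have "\<dots> \<le> liminf (\<lambda>n. ennreal K)"
    proof (intro Liminf_mono always_eventually allI)
      fix n
      have "u (r n) \<in> C 0" using uC[of "r n"] C_anti[of 0 "r n"] by auto
      then show "(\<integral>\<^sup>+x. ennreal (norm (u (r n) x)) \<partial>M) \<le> ennreal K"
        using K int by (subst nn_integral_eq_integral) (auto intro!: ennreal_leI)
    qed
    also have "\<dots> < \<infinity>" by (simp add: Liminf_const)
    finally show "(\<integral>\<^sup>+x. ennreal (norm (v x)) \<partial>M) < \<infinity>" .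
  qed simp
  have "J v \<le> liminf (\<lambda>n. J (u (r n)))" using lsc[OF int vint lim] .
  also have "\<dots> \<le> liminf (\<lambda>n. a + ennreal (e (r n)))"
    using uC unfolding C_def by (intro Liminf_mono always_eventually) auto
  also have "\<dots> = a"
  proof -
    have "(\<lambda>n. e (r n)) \<longlonglongrightarrow> 0"
      using LIMSEQ_subseq_LIMSEQ[OF e_lim r] by (simp add: o_def)
    then have "(\<lambda>n. a + ennreal (e (r n))) \<longlonglongrightarrow> a + ennreal 0"
      by (intro tendsto_intros)
    then show ?thesis by (simp add: lim_imp_Liminf)
  qed
  finally have "J v \<le> a" .
  then have "is_arg_min J (integrable M) v"
    unfolding is_arg_min_def using vint a_le by (auto simp: not_less intro: order_trans)
  then show ?thesis by blast
qed

section \<open>The total variation functional of a reversible random walk\<close>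

lemma random_walk_measurable_kernel:
  assumes "metric_random_walk m" and sets: "sets \<nu> = sets borel"
  shows "m \<in> measurable \<nu> (subprob_algebra borel)"
proof (rule measurable_subprob_algebra)
  show "subprob_space (m x)" for x
    using assms unfolding metric_random_walk_def by (simp add: prob_space_imp_subprob_space)
  show "sets (m x) = sets borel" for x
    using assms unfolding metric_random_walk_def by simp
  show "(\<lambda>x. emeasure (m x) A) \<in> borel_measurable \<nu>" if "A \<in> sets borel" for A
    using assms that unfolding metric_random_walk_def
    by (simp cong: measurable_cong_sets)
qed

text \<open>
  Reversibility applied to \<open>N \<times> X\<close> gives \<open>\<nu>(N) = \<integral> m\<^sub>y(N) d\<nu>(y)\<close>, so a \<open>\<nu>\<close>-null set \<open>N\<close> is
  \<open>m\<^sub>y\<close>-null for \<open>\<nu>\<close>-almost every \<open>y\<close>.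
\<close>

lemma reversible_imp_AE_AE:
  fixes m :: "'a::polish_space \<Rightarrow> 'a measure"
  assumes walk: "metric_random_walk m" and sets: "sets \<nu> = sets borel"
    and rev: "reversible m \<nu>" and AE: "AE y in \<nu>. P y"
  shows "AE x in \<nu>. AE y in m x. P y"
proof -
  have sm: "sets (m x) = sets borel" for x using walk unfolding metric_random_walk_def by simp
  obtain N where N: "N \<in> null_sets \<nu>" "{y \<in> space \<nu>. \<not> P y} \<subseteq> N"
    using AE by (auto simp: eventually_ae_filter)
  have Nb[measurable]: "N \<in> sets borel" using N(1) sets by (auto simp: null_sets_def)
  have "N \<times> UNIV \<in> sets (borel \<Otimes>\<^sub>M (borel :: 'a measure))" by simp
  then have "(\<integral>\<^sup>+ x. (\<integral>\<^sup>+ y. indicator (N \<times> UNIV) (x, y) \<partial>m x) \<partial>\<nu>) =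
     (\<integral>\<^sup>+ y. (\<integral>\<^sup>+ x. indicator (N \<times> UNIV) (x, y) \<partial>m y) \<partial>\<nu>)"
    using rev unfolding reversible_def by blast
  moreover have "(\<integral>\<^sup>+ x. (\<integral>\<^sup>+ y. indicator (N \<times> UNIV) (x, y) \<partial>m x) \<partial>\<nu>) = 0"
  proof -
    have "AE x in \<nu>. x \<notin> N" using N(1) by (rule AE_not_in)
    then have "AE x in \<nu>. (\<integral>\<^sup>+ y. indicator (N \<times> UNIV) (x, y) \<partial>m x) = 0"
      by eventually_elim simp
    then show ?thesis by (simp add: nn_integral_cong_AE)
  qed
  moreover have "(\<integral>\<^sup>+ x. indicator (N \<times> UNIV) (x, y) \<partial>m y) = emeasure (m y) N" for y
    using Nb sm by (simp add: indicator_times)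
  ultimately have "(\<integral>\<^sup>+ y. emeasure (m y) N \<partial>\<nu>) = 0" by simp
  moreover have "(\<lambda>y. emeasure (m y) N) \<in> borel_measurable \<nu>"
    using walk Nb sets unfolding metric_random_walk_def by (simp cong: measurable_cong_sets)
  ultimately have "AE x in \<nu>. emeasure (m x) N = 0"
    by (simp add: nn_integral_0_iff_AE)
  then show ?thesis
  proof eventually_elim
    case (elim x)
    have "N \<in> null_sets (m x)" using elim Nb sm by (simp add: null_sets_def)
    moreover have "{y \<in> space (m x). \<not> P y} \<subseteq> N"
      using N(2) sets_eq_imp_space_eq[OF sets] by auto
    ultimately show ?case by (rule AE_I')
  qed
qed

text \<open>
  Both terms of the objective are put under one iterated integral. Convexity and semicontinuity
  then follow from pointwise properties of a single nonnegative integrand, and no sum of lower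
  limits has to be estimated.
\<close>

definition energy :: "('a \<Rightarrow> 'a measure) \<Rightarrow> 'a measure \<Rightarrow> ('a \<Rightarrow> real) \<Rightarrow> real \<Rightarrow> ('a \<Rightarrow> real) \<Rightarrow> ennreal" where
  "energy m \<nu> f lam u =
     (\<integral>\<^sup>+ x. (\<integral>\<^sup>+ y. ennreal (\<bar>u y - u x\<bar> / 2 + lam * \<bar>u x - f x\<bar>) \<partial>m x) \<partial>\<nu>)"

context
  fixes m :: "'a::polish_space \<Rightarrow> 'a measure" and \<nu> :: "'a measure"
    and f :: "'a \<Rightarrow> real" and lam :: real
  assumes walk: "metric_random_walk m" and sets\<nu>: "sets \<nu> = sets borel"
    and fm: "f \<in> borel_measurable borel" and lam: "lam > 0"
begin

lemma random_walk_sets: "sets (m x) = sets borel" and random_walk_prob: "prob_space (m x)"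
  using walk unfolding metric_random_walk_def by auto

lemma measurable_random_walk_iff:
  "g \<in> borel_measurable (m x) \<longleftrightarrow> g \<in> borel_measurable borel"
  "g \<in> borel_measurable \<nu> \<longleftrightarrow> g \<in> borel_measurable borel"
  by (auto simp: random_walk_sets sets\<nu> cong: measurable_cong_sets)

lemma borel_measurable_kernel_integral:
  assumes "(\<lambda>(x, y). g x y) \<in> borel_measurable (borel \<Otimes>\<^sub>M borel)"
  shows "(\<lambda>x. \<integral>\<^sup>+ y. g x y \<partial>m x) \<in> borel_measurable \<nu>"
proof (rule nn_integral_measurable_subprob_algebra2[OF _ random_walk_measurable_kernel[OF walk sets\<nu>]])
  show "(\<lambda>(x, y). g x y) \<in> borel_measurable (\<nu> \<Otimes>\<^sub>M borel)"
    by (subst measurable_cong_sets[OF sets_pair_measure_cong[OF sets\<nu> refl] refl]) (fact assms)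
qed

lemma borel_measurable_energy_density:
  assumes [measurable]: "u \<in> borel_measurable borel"
  shows "(\<lambda>(x, y). ennreal (\<bar>u y - u x\<bar> / 2 + lam * \<bar>u x - f x\<bar>)) \<in> borel_measurable (borel \<Otimes>\<^sub>M borel)"
  using fm by measurable

text \<open>The fidelity term passes under the inner integral because every \<open>m\<^sub>x\<close> has total mass 1.\<close>

lemma energy_eq:
  assumes u[measurable]: "u \<in> borel_measurable borel"
  shows "energy m \<nu> f lam u = TV m \<nu> u + ennreal lam * (\<integral>\<^sup>+ x. ennreal \<bar>u x - f x\<bar> \<partial>\<nu>)"
proof -
  note [measurable] = fm
  have "(1 / 2 :: ennreal) = ennreal (1 / 2)"
    by (metis ennreal_1 ennreal_divide_numeral zero_le_one)
  then have half: "ennreal (t / 2) = (1 / 2) * ennreal t" if "t \<ge> 0" for t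
    using that ennreal_mult[of "1 / 2" t] by (metis mult.left_neutral times_divide_eq_left
        zero_le_divide_1_iff zero_le_numeral)
  have "energy m \<nu> f lam u = (\<integral>\<^sup>+ x. (1 / 2) * (\<integral>\<^sup>+ y. ennreal \<bar>u y - u x\<bar> \<partial>m x)
      + ennreal lam * ennreal \<bar>u x - f x\<bar> \<partial>\<nu>)"
    unfolding energy_def
  proof (rule nn_integral_cong)
    fix x
    interpret prob_space "m x" by (rule random_walk_prob)
    have [measurable]: "u \<in> borel_measurable (m x)" using u by (simp add: measurable_random_walk_iff)
    have "(\<integral>\<^sup>+ y. ennreal (\<bar>u y - u x\<bar> / 2 + lam * \<bar>u x - f x\<bar>) \<partial>m x) =
       (\<integral>\<^sup>+ y. (1 / 2) * ennreal \<bar>u y - u x\<bar> + ennreal lam * ennreal \<bar>u x - f x\<bar> \<partial>m x)"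
      using lam by (intro nn_integral_cong) (simp add: half ennreal_mult)
    also have "\<dots> = (1 / 2) * (\<integral>\<^sup>+ y. ennreal \<bar>u y - u x\<bar> \<partial>m x) + ennreal lam * ennreal \<bar>u x - f x\<bar>"
      by (simp add: nn_integral_add nn_integral_cmult emeasure_space_1)
    finally show "(\<integral>\<^sup>+ y. ennreal (\<bar>u y - u x\<bar> / 2 + lam * \<bar>u x - f x\<bar>) \<partial>m x) =
      (1 / 2) * (\<integral>\<^sup>+ y. ennreal \<bar>u y - u x\<bar> \<partial>m x) + ennreal lam * ennreal \<bar>u x - f x\<bar>" .
  qed
  also have "\<dots> = TV m \<nu> u + ennreal lam * (\<integral>\<^sup>+ x. ennreal \<bar>u x - f x\<bar> \<partial>\<nu>)"
  proof -
    have [measurable]: "u \<in> borel_measurable \<nu>" "f \<in> borel_measurable \<nu>"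
      using u fm by (simp_all add: measurable_random_walk_iff)
    have [measurable]: "(\<lambda>x. \<integral>\<^sup>+ y. ennreal \<bar>u y - u x\<bar> \<partial>m x) \<in> borel_measurable \<nu>"
      by (intro borel_measurable_kernel_integral) measurable
    show ?thesis
      unfolding TV_def by (simp add: nn_integral_add nn_integral_cmult)
  qed
  finally show ?thesis .
qed

lemma energy_midpoint_le:
  assumes u[measurable]: "u \<in> borel_measurable borel" and v[measurable]: "v \<in> borel_measurable borel"
    and "energy m \<nu> f lam u \<le> c" "energy m \<nu> f lam v \<le> c"
  shows "energy m \<nu> f lam (\<lambda>x. (u x + v x) / 2) \<le> c"
proof -
  define g where "g w x y = ennreal (\<bar>w y - w x\<bar> / 2 + lam * \<bar>w x - f x\<bar>)" for w x y
  have E: "energy m \<nu> f lam w = (\<integral>\<^sup>+ x. \<integral>\<^sup>+ y. g w x y \<partial>m x \<partial>\<nu>)" for w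
    unfolding energy_def g_def ..
  have gm: "g w x \<in> borel_measurable (m x)" "(\<lambda>x. \<integral>\<^sup>+ y. g w x y \<partial>m x) \<in> borel_measurable \<nu>"
    if [measurable]: "w \<in> borel_measurable borel" for w x
  proof -
    show "g w x \<in> borel_measurable (m x)" unfolding g_def measurable_random_walk_iff by measurable
    show "(\<lambda>x. \<integral>\<^sup>+ y. g w x y \<partial>m x) \<in> borel_measurable \<nu>"
      unfolding g_def by (intro borel_measurable_kernel_integral borel_measurable_energy_density that)
  qed
  have g2: "2 * g (\<lambda>x. (u x + v x) / 2) x y \<le> g u x y + g v x y" for x y
  proof -
    have diff: "(u y + v y) / 2 - (u x + v x) / 2 = ((u y - u x) + (v y - v x)) / 2"
      "(u x + v x) / 2 - f x = ((u x - f x) + (v x - f x)) / 2"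
      by (simp_all add: field_simps)
    have "2 * (\<bar>(u y + v y) / 2 - (u x + v x) / 2\<bar> / 2) \<le> \<bar>u y - u x\<bar> / 2 + \<bar>v y - v x\<bar> / 2"
      unfolding diff using abs_triangle_ineq[of "u y - u x" "v y - v x"] by simp
    moreover have "lam * (2 * \<bar>(u x + v x) / 2 - f x\<bar>) \<le> lam * (\<bar>u x - f x\<bar> + \<bar>v x - f x\<bar>)"
      unfolding diff using lam abs_triangle_ineq[of "u x - f x" "v x - f x"]
      by (intro mult_left_mono) auto
    ultimately have "2 * (\<bar>(u y + v y) / 2 - (u x + v x) / 2\<bar> / 2 + lam * \<bar>(u x + v x) / 2 - f x\<bar>) \<le>
      (\<bar>u y - u x\<bar> / 2 + lam * \<bar>u x - f x\<bar>) + (\<bar>v y - v x\<bar> / 2 + lam * \<bar>v x - f x\<bar>)"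
      by (simp add: algebra_simps)
    note le = ennreal_leI[OF this]
    have two: "ennreal (2 * t) = 2 * ennreal t" for t
      by (simp add: ennreal_mult')
    have pos: "0 \<le> \<bar>w y - w x\<bar> / 2 + lam * \<bar>w x - f x\<bar>" for w :: "'a \<Rightarrow> real"
      using lam by simp
    show ?thesis
      unfolding g_def two[symmetric] ennreal_plus[OF pos pos, symmetric] by (rule le)
  qed
  have "2 * energy m \<nu> f lam (\<lambda>x. (u x + v x) / 2) =
      (\<integral>\<^sup>+ x. \<integral>\<^sup>+ y. 2 * g (\<lambda>x. (u x + v x) / 2) x y \<partial>m x \<partial>\<nu>)"
    unfolding E by (simp add: nn_integral_cmult gm)
  also have "\<dots> \<le> (\<integral>\<^sup>+ x. \<integral>\<^sup>+ y. g u x y + g v x y \<partial>m x \<partial>\<nu>)"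
    by (intro nn_integral_mono g2)
  also have "\<dots> = energy m \<nu> f lam u + energy m \<nu> f lam v"
    unfolding E by (simp add: nn_integral_add gm u v)
  also have "\<dots> \<le> c + c" using assms(3,4) by (rule add_mono)
  finally have "2 * energy m \<nu> f lam (\<lambda>x. (u x + v x) / 2) \<le> 2 * c" by (simp add: mult_2)
  then show ?thesis by (simp add: ennreal_mult_le_mult_iff)
qed

text \<open>
  The integrand at \<open>(x, y)\<close> depends continuously on the values of the function at \<open>x\<close> and \<open>y\<close>,
  and both converge for \<open>\<nu>\<close>-almost every \<open>x\<close> and \<open>m\<^sub>x\<close>-almost every \<open>y\<close>. Fatou's lemma is used
  twice, for the inner and for the outer integral.
\<close>

lemma energy_liminf:
  fixes u :: "nat \<Rightarrow> 'a \<Rightarrow> real"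
  assumes rev: "reversible m \<nu>"
    and u[measurable]: "\<And>n. u n \<in> borel_measurable borel"
    and lim: "AE x in \<nu>. (\<lambda>n. u n x) \<longlonglongrightarrow> v x"
  shows "energy m \<nu> f lam v \<le> liminf (\<lambda>n. energy m \<nu> f lam (u n))"
proof -
  define g where "g w x y = ennreal (\<bar>w y - w x\<bar> / 2 + lam * \<bar>w x - f x\<bar>)" for w x y
  have E: "energy m \<nu> f lam w = (\<integral>\<^sup>+ x. \<integral>\<^sup>+ y. g w x y \<partial>m x \<partial>\<nu>)" for w
    unfolding energy_def g_def ..
  have gm: "g (u n) x \<in> borel_measurable (m x)" "(\<lambda>x. \<integral>\<^sup>+ y. g (u n) x y \<partial>m x) \<in> borel_measurable \<nu>" for n x
  proof -
    show "g (u n) x \<in> borel_measurable (m x)" unfolding g_def measurable_random_walk_iff by measurable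
    show "(\<lambda>x. \<integral>\<^sup>+ y. g (u n) x y \<partial>m x) \<in> borel_measurable \<nu>"
      unfolding g_def by (intro borel_measurable_kernel_integral borel_measurable_energy_density u)
  qed
  have "AE x in \<nu>. (\<integral>\<^sup>+ y. g v x y \<partial>m x) \<le> liminf (\<lambda>n. \<integral>\<^sup>+ y. g (u n) x y \<partial>m x)"
    using lim reversible_imp_AE_AE[OF walk sets\<nu> rev lim]
  proof eventually_elim
    case (elim x)
    have "(\<integral>\<^sup>+ y. g v x y \<partial>m x) = (\<integral>\<^sup>+ y. liminf (\<lambda>n. g (u n) x y) \<partial>m x)"
    proof (rule nn_integral_cong_AE, use elim(2) in eventually_elim)
      case (elim y)
      with \<open>(\<lambda>n. u n x) \<longlonglongrightarrow> v x\<close> have "(\<lambda>n. g (u n) x y) \<longlonglongrightarrow> g v x y"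
        unfolding g_def by (intro tendsto_intros) auto
      then show ?case by (simp add: lim_imp_Liminf)
    qed
    also have "\<dots> \<le> liminf (\<lambda>n. \<integral>\<^sup>+ y. g (u n) x y \<partial>m x)"
      by (intro nn_integral_liminf gm)
    finally show ?case .
  qed
  then have "energy m \<nu> f lam v \<le> (\<integral>\<^sup>+ x. liminf (\<lambda>n. \<integral>\<^sup>+ y. g (u n) x y \<partial>m x) \<partial>\<nu>)"
    unfolding E by (rule nn_integral_mono_AE)
  also have "\<dots> \<le> liminf (\<lambda>n. energy m \<nu> f lam (u n))"
    unfolding E by (intro nn_integral_liminf gm)
  finally show ?thesis .
qed

text \<open>Coercivity comes from the fidelity term alone, by the triangle inequality.\<close>

lemma integral_abs_le_of_energy_le:
  assumes f: "integrable \<nu> f" and u: "integrable \<nu> u"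
    and le: "energy m \<nu> f lam u \<le> ennreal c" and c: "c \<ge> 0"
  shows "(\<integral>x. \<bar>u x\<bar> \<partial>\<nu>) \<le> c / lam + (\<integral>x. \<bar>f x\<bar> \<partial>\<nu>)"
proof -
  have um: "u \<in> borel_measurable borel" using u measurable_random_walk_iff(2) by auto
  have "ennreal (lam * (\<integral>x. \<bar>u x - f x\<bar> \<partial>\<nu>)) = ennreal lam * (\<integral>\<^sup>+ x. ennreal \<bar>u x - f x\<bar> \<partial>\<nu>)"
    using u f lam by (subst nn_integral_eq_integral) (auto simp: ennreal_mult)
  also have "\<dots> \<le> energy m \<nu> f lam u"
    unfolding energy_eq[OF um] by simp
  also note le
  finally have "lam * (\<integral>x. \<bar>u x - f x\<bar> \<partial>\<nu>) \<le> c" using c by (simp add: ennreal_le_iff)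
  then have "(\<integral>x. \<bar>u x - f x\<bar> \<partial>\<nu>) \<le> c / lam" using lam by (simp add: field_simps)
  moreover have "(\<integral>x. \<bar>u x\<bar> \<partial>\<nu>) \<le> (\<integral>x. \<bar>u x - f x\<bar> + \<bar>f x\<bar> \<partial>\<nu>)"
    using u f by (intro integral_mono) auto
  moreover have "\<dots> = (\<integral>x. \<bar>u x - f x\<bar> \<partial>\<nu>) + (\<integral>x. \<bar>f x\<bar> \<partial>\<nu>)"
    using u f by (intro Bochner_Integration.integral_add) auto
  ultimately show ?thesis by linarith
qed

end

section \<open>Existence of a minimizer\<close>

theorem theorem3p11:
  fixes m :: "'a::polish_space \<Rightarrow> 'a measure"
    and \<nu> :: "'a measure"
    and f :: "'a \<Rightarrow> real"
    and lam :: real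
  assumes "metric_random_walk m"
    and "finite_radon_measure \<nu>"
    and "emeasure \<nu> UNIV \<noteq> 0"
    and "reversible m \<nu>"
    and "ergodic m \<nu>"
    and "integrable \<nu> f"
    and "lam > 0"
  shows "\<exists>u. is_arg_min
           (\<lambda>u. TV m \<nu> u + ennreal lam * (\<integral>\<^sup>+ x. ennreal \<bar>u x - f x\<bar> \<partial>\<nu>))
           (\<lambda>u. integrable \<nu> u) u"
proof -
  have sets: "sets \<nu> = sets borel" and fin: "finite_measure \<nu>"
    using assms(2) unfolding finite_radon_measure_def by auto
  interpret finite_measure \<nu> by (rule fin)
  have meas: "w \<in> borel_measurable borel" if "integrable \<nu> w" for w :: "'a \<Rightarrow> real"
    using borel_measurable_integrable[OF that] sets by (simp cong: measurable_cong_sets)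
  note ctx = assms(1) sets meas[OF assms(6)] assms(7)
  have "\<exists>u. is_arg_min (energy m \<nu> f lam) (integrable \<nu>) u"
  proof (rule convex_coercive_minimizer, goal_cases)
    case (1 u v c)
    then show ?case by (intro energy_midpoint_le[OF ctx] meas)
  next
    case (2 c)
    then obtain k where "c = ennreal k" "k \<ge> 0" by (cases c) auto
    then show ?case using integral_abs_le_of_energy_le[OF ctx assms(6)] by blast
  next
    case (3 u v)
    then show ?case by (intro energy_liminf[OF ctx assms(4)] meas)
  qed
  then obtain u where u: "is_arg_min (energy m \<nu> f lam) (integrable \<nu>) u" ..
  have "is_arg_min (\<lambda>u. TV m \<nu> u + ennreal lam * (\<integral>\<^sup>+ x. ennreal \<bar>u x - f x\<bar> \<partial>\<nu>)) (integrable \<nu>) u"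
    using u unfolding is_arg_min_def by (simp add: energy_eq[OF ctx, symmetric] meas)
  then show ?thesis by blast
qed

end
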